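(* For every integer $d \ge 1$ there is a constant $c_d > 0$, depending only on $d$, such that for every full-dimensional lattice polytope $P$ in $\mathbb{R}^d$, $$|\operatorname{vert}(P)| \le c_d \operatorname{Vol}(P)^{\frac{d-1}{d+1}}.$$
   Context: A lattice polytope in $\mathbb{R}^d$ is the convex hull of a finite set of points of $\mathbb{Z}^d$, i.e. a polytope all of whose vertices are in $\mathbb{Z}^d$. Full-dimensional means not contained in a hyperplane. $\operatorname{vert}(P)$ is the set of vertices of $P$, and $\operatorname{Vol}$ is $d$-dimensional Lebesgue measure. *)

theory Defs
  imports "HOL-Analysis.Analysis"
begin

definition integer_lattice :: "(real ^ 'n) set" where
  "integer_lattice = {x. \<forall>i. x $ i \<in> \<int>}"

definition lattice_polytope :: "(real ^ 'n) set \<Rightarrow> bool" where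
  "lattice_polytope P \<longleftrightarrow> (\<exists>S. finite S \<and> S \<subseteq> integer_lattice \<and> P = convex hull S)"

definition full_dimensional :: "(real ^ 'n) set \<Rightarrow> bool" where
  "full_dimensional P \<longleftrightarrow> \<not> (\<exists>a b. a \<noteq> 0 \<and> P \<subseteq> {x. a \<bullet> x = b})"

definition vert :: "(real ^ 'n) set \<Rightarrow> (real ^ 'n) set" where
  "vert P = {v. v extreme_point_of P}"

(* In particular, card (vert P) is the true number of vertices of a lattice polytope P. *)
lemma finite_vert: "lattice_polytope P \<Longrightarrow> finite (vert P)"
  unfolding lattice_polytope_def vert_def
  by (auto intro: finite_subset dest: extreme_point_of_convex_hull)

end

theory Submission
  imports Defs
begin

text \<open>
  Write \<open>d\<close> for the dimension, \<open>V\<close> for the set of vertices of \<open>P\<close> and \<open>N\<close> for their number.  The proof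
  plays two facts against each other.

  Sparse approximation: a convex polytope is well approximated from inside by the hull of few of its
  own vertices.  For \<open>0 < r \<le> 1/2\<close> there is \<open>W \<subseteq> V\<close> with \<open>O(r^(1-d))\<close> elements such that \<open>convex hull W\<close>
  contains a translate of \<open>(1 - 2r^2) P\<close>; this is \<open>sparse_approximating_subset\<close>.  The exponents are those of a sphere:
  caps of height \<open>r^2\<close> have width about \<open>r\<close>, and \<open>r^(1-d)\<close> of them cover the surface.  The
  constant depends on \<open>d\<close> alone because the assertion is affinely invariant, so \<open>P\<close> may be assumed to
  lie between two balls of fixed radii (\<open>normalizing_affine_map\<close>).

  Discreteness: adding a lattice point outside a full-dimensional lattice polytope raises the volume
  by at least \<open>d^(-d)\<close>, because a facet visible from the new point spans with it a nondegenerate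
  lattice simplex outside the old polytope (\<open>lattice_point_adds_volume\<close>).

  Now the vertices outside \<open>W\<close> are added to \<open>convex hull W\<close> one at a time.  The total gain is at most
  the volume missing from \<open>convex hull W\<close>, which is \<open>O(r^2 Vol P)\<close>.  Hence
  \<open>N = O(r^(1-d)) + O(r^2 Vol P)\<close> for every admissible \<open>r\<close> (\<open>card_vert_le_two_scale\<close>), and the two terms balance at
  \<open>r\<close> of the order \<open>(Vol P)^(-1/(d+1))\<close>, which gives the exponent \<open>(d-1)/(d+1)\<close>.
\<close>

section \<open>Sparse approximation of a normalized polytope\<close>

lemma measure_dilation:
  fixes S :: "'a::euclidean_space set"
  shows "measure lebesgue ((\<lambda>x. m *\<^sub>R x + a) ` S) = \<bar>m\<bar> ^ DIM('a) * measure lebesgue S"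
  using measure_lebesgue_affine[of m a S] by simp

lemma power_diff_shell_bound:
  fixes r :: real
  assumes "0 \<le> r" "r \<le> 1"
  shows "(1 + r) ^ n - (1 - r) ^ n \<le> 2 * r * (real n * 2 ^ (n - 1))"
proof -
  have "(\<Sum>i<n. (1 - r) ^ (n - Suc i) * (1 + r) ^ i) \<le> (\<Sum>i<n. 2 ^ (n - 1))"
  proof (rule sum_mono)
    fix i assume i: "i \<in> {..<n}"
    have "(1 - r) ^ (n - Suc i) * (1 + r) ^ i \<le> 1 * 2 ^ i"
      using assms by (intro mult_mono power_le_one power_mono) auto
    also have "\<dots> \<le> 2 ^ (n - 1)"
      using i by (simp add: power_increasing)
    finally show "(1 - r) ^ (n - Suc i) * (1 + r) ^ i \<le> 2 ^ (n - 1)" .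
  qed
  then have "(1 + r - (1 - r)) * (\<Sum>i<n. (1 - r) ^ (n - Suc i) * (1 + r) ^ i)
      \<le> (1 + r - (1 - r)) * (real n * 2 ^ (n - 1))"
    using assms by (intro mult_left_mono) auto
  then show ?thesis
    by (simp only: power_diff_sumr2[of "1 + r" n "1 - r"]) (simp add: algebra_simps)
qed

text \<open>
  For \<open>v \<in> V\<close> maximal in the unit direction \<open>u\<close>, the point \<open>v + u\<close> lies on the boundary of the body \<open>L\<close>
  of all points at distance at most one from \<open>convex hull V\<close>.  Balls of radius \<open>r\<close> about such points
  therefore lie in the shell between \<open>(1 - r) L\<close> and \<open>(1 + r) L\<close>, whose volume is of order \<open>r\<close>.  Disjoint
  balls have volumes of order \<open>r^d\<close>, so there are only \<open>O(r^(1-d))\<close> of them: a packing bound for a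
  \<open>(d-1)\<close>-dimensional surface obtained from volumes alone.
\<close>
lemma outer_parallel_packing:
  fixes V :: "'a::euclidean_space set" and J :: "('a \<times> 'a) set"
  assumes V: "V \<subseteq> cball 0 R" "0 \<in> convex hull V" and "finite J"
    and J: "\<And>v u. (v, u) \<in> J \<Longrightarrow> v \<in> V \<and> norm u = 1 \<and> (\<forall>w\<in>V. u \<bullet> w \<le> u \<bullet> v)"
    and sep: "\<And>v u v' u'. \<lbrakk>(v, u) \<in> J; (v', u') \<in> J; (v, u) \<noteq> (v', u')\<rbrakk> \<Longrightarrow> 2 * r \<le> dist (v + u) (v' + u')"
    and r: "0 < r" "r \<le> 1"
  shows "real (card J) \<le> (2 * (R + 1)) ^ DIM('a) * real DIM('a) / r ^ (DIM('a) - 1)"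
proof -
  let ?n = "DIM('a)"
  define L where "L = (\<Union>x\<in>convex hull V. \<Union>y\<in>cball 0 1. {x + y})"
  define B where "B = (\<lambda>(v :: 'a, u). ball (v + u) r)"
  have K: "convex hull V \<subseteq> cball 0 R"
    using V by (simp add: subset_hull)
  have R: "0 \<le> R"
    using K V(2) by auto
  have "convex L"
    unfolding L_def by (intro convex_sums) auto
  have L_R: "L \<subseteq> cball 0 (R + 1)"
  proof
    fix z assume "z \<in> L"
    then obtain x y where "x \<in> convex hull V" "norm y \<le> 1" "z = x + y"
      by (auto simp: L_def)
    then show "z \<in> cball 0 (R + 1)"
      using K norm_triangle_ineq[of x y] by force
  qed
  have "cball 0 1 \<subseteq> L"
    using V(2) unfolding L_def by force
  then have "0 \<in> L"
    by auto
  have scaled_lmeas: "(\<lambda>x. m *\<^sub>R x + 0) ` L \<in> lmeasurable" for m :: real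
    using \<open>convex L\<close> L_R
    by (intro measurable_convex) (auto intro: convex_scaling bounded_scaling bounded_subset[OF bounded_cball])
  have inner_sub: "(\<lambda>x. (1 - r) *\<^sub>R x + 0) ` L \<subseteq> (\<lambda>x. (1 + r) *\<^sub>R x + 0) ` L"
  proof clarsimp
    fix x assume "x \<in> L"
    have "0 \<le> (1 - r) / (1 + r)" "0 \<le> 1 - (1 - r) / (1 + r)"
      using r by (auto simp: field_simps)
    then have "((1 - r) / (1 + r)) *\<^sub>R x + (1 - (1 - r) / (1 + r)) *\<^sub>R 0 \<in> L"
      using \<open>x \<in> L\<close> \<open>0 \<in> L\<close> \<open>convex L\<close> by (intro convexD) auto
    then show "(1 - r) *\<^sub>R x \<in> (*\<^sub>R) (1 + r) ` L"
      using r by (intro image_eqI[of _ _ "((1 - r) / (1 + r)) *\<^sub>R x"]) auto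
  qed
  \<comment> \<open>\<open>v + u\<close> maximizes \<open>u\<close> over \<open>L\<close>, and the maximum is at least one since \<open>0\<close> lies in the hull of \<open>V\<close>.\<close>
  have support: "u \<bullet> x \<le> u \<bullet> (v + u) \<and> 1 \<le> u \<bullet> (v + u)" if "(v, u) \<in> J" "x \<in> L" for v u x
  proof -
    have u: "norm u = 1" "u \<bullet> u = 1" "\<forall>w\<in>V. u \<bullet> w \<le> u \<bullet> v"
      using J[OF that(1)] by (auto simp: norm_eq_1)
    have "V \<subseteq> {x. u \<bullet> x \<le> u \<bullet> v}"
      using u by auto
    then have hull: "convex hull V \<subseteq> {x. u \<bullet> x \<le> u \<bullet> v}"
      by (simp add: convex_halfspace_le subset_hull)
    obtain p q where pq: "p \<in> convex hull V" "norm q \<le> 1" "x = p + q"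
      using \<open>x \<in> L\<close> by (auto simp: L_def)
    have "u \<bullet> q \<le> 1"
      using norm_cauchy_schwarz[of u q] u pq by auto
    moreover have "u \<bullet> p \<le> u \<bullet> v"
      using hull pq by auto
    moreover have "0 \<le> u \<bullet> v"
      using hull V(2) by auto
    ultimately show ?thesis
      using u pq by (simp add: inner_add_right)
  qed
  have B_outer: "B j \<subseteq> (\<lambda>x. (1 + r) *\<^sub>R x + 0) ` L" if "j \<in> J" for j
  proof
    fix z assume "z \<in> B j"
    obtain v u where j: "j = (v, u)" by force
    have z: "norm (z - (v + u)) < r"
      using \<open>z \<in> B j\<close> by (simp add: B_def j dist_norm norm_minus_commute)
    have "v + u \<in> L"
      using J[of v u] that j hull_subset[of V convex] by (force simp: L_def)
    moreover have "(1 / r) *\<^sub>R (z - (v + u)) \<in> L"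
    proof (rule subsetD[OF \<open>cball 0 1 \<subseteq> L\<close>])
      have "norm ((1 / r) *\<^sub>R (z - (v + u))) = norm (z - (v + u)) / r"
        using r by simp
      also have "\<dots> \<le> 1"
        using z r by simp
      finally show "(1 / r) *\<^sub>R (z - (v + u)) \<in> cball 0 1"
        by simp
    qed
    moreover have "1 / (1 + r) + r / (1 + r) = 1"
      using r by (simp flip: add_divide_distrib)
    ultimately have "(1 / (1 + r)) *\<^sub>R (v + u) + (r / (1 + r)) *\<^sub>R ((1 / r) *\<^sub>R (z - (v + u))) \<in> L"
      using \<open>convex L\<close> r by (intro convexD) auto
    also have "(1 / (1 + r)) *\<^sub>R (v + u) + (r / (1 + r)) *\<^sub>R ((1 / r) *\<^sub>R (z - (v + u))) = (1 / (1 + r)) *\<^sub>R z"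
      using r by (simp add: algebra_simps)
    finally show "z \<in> (\<lambda>x. (1 + r) *\<^sub>R x + 0) ` L"
      using r by (intro image_eqI[of _ _ "(1 / (1 + r)) *\<^sub>R z"]) auto
  qed
  \<comment> \<open>The value of \<open>u\<close> exceeds \<open>u \<bullet> (v + u) - r\<close> on the ball but is at most \<open>(1 - r) (u \<bullet> (v + u))\<close> on \<open>(1 - r) L\<close>.\<close>
  have B_inner: "B j \<inter> (\<lambda>x. (1 - r) *\<^sub>R x + 0) ` L = {}" if "j \<in> J" for j
  proof -
    obtain v u where j: "j = (v, u)" by force
    have False if "x \<in> L" "(1 - r) *\<^sub>R x \<in> B j" for x
    proof -
      have u: "norm u = 1" using J[of v u] \<open>j \<in> J\<close> j by auto
      have s: "u \<bullet> x \<le> u \<bullet> (v + u)" "1 \<le> u \<bullet> (v + u)"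
        using support[of v u x] \<open>j \<in> J\<close> j that by auto
      have "u \<bullet> (v + u) - u \<bullet> ((1 - r) *\<^sub>R x) \<le> norm u * norm (v + u - (1 - r) *\<^sub>R x)"
        using norm_cauchy_schwarz[of u "v + u - (1 - r) *\<^sub>R x"] by (simp add: inner_diff_right)
      also have "\<dots> < r"
        using that by (simp add: u B_def j dist_norm)
      finally have "u \<bullet> (v + u) - r < (1 - r) * (u \<bullet> x)"
        by simp
      also have "\<dots> \<le> (1 - r) * (u \<bullet> (v + u))"
        using s r by (intro mult_left_mono) auto
      also have "\<dots> \<le> u \<bullet> (v + u) - r"
        using s r mult_left_mono[of 1 "u \<bullet> (v + u)" r] by (simp add: left_diff_distrib)
      finally show False by simp
    qed
    then show ?thesis by auto
  qed
  have "disjoint_family_on B J"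
    unfolding disjoint_family_on_def
  proof (intro ballI impI)
    fix j j' assume j: "j \<in> J" "j' \<in> J" "j \<noteq> j'"
    have "2 * r \<le> dist (fst j + snd j) (fst j' + snd j')"
      using sep[of "fst j" "snd j" "fst j'" "snd j'"] j by simp
    moreover have "dist (fst j + snd j) (fst j' + snd j') < 2 * r" if "x \<in> B j" "x \<in> B j'" for x
      using that dist_triangle2[of "fst j + snd j" "fst j' + snd j'" x]
      by (simp add: B_def case_prod_beta)
    ultimately show "B j \<inter> B j' = {}"
      by force
  qed
  define b where "b = measure lebesgue (ball (0::'a) 1)"
  have ball_measure: "measure lebesgue (ball a s) = b * s ^ ?n" if "0 \<le> s" for a :: 'a and s
    using that by (simp add: b_def measure_completion content_ball)
  have "b > 0"
    by (simp add: b_def measure_completion)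
  have "real (card J) * (b * r ^ ?n) = (\<Sum>j\<in>J. measure lebesgue (B j))"
    using r by (simp add: B_def case_prod_beta ball_measure del: measure_completion)
  also have "\<dots> = measure lebesgue (\<Union>j\<in>J. B j)"
    using \<open>disjoint_family_on B J\<close> \<open>finite J\<close>
    by (intro measure_UNION'[symmetric]) (auto simp: B_def disjoint_family_on_def pairwise_def disjnt_def)
  also have "\<dots> \<le> measure lebesgue ((\<lambda>x. (1 + r) *\<^sub>R x + 0) ` L - (\<lambda>x. (1 - r) *\<^sub>R x + 0) ` L)"
  proof (rule measure_mono_fmeasurable)
    show "(\<Union>j\<in>J. B j) \<subseteq> (\<lambda>x. (1 + r) *\<^sub>R x + 0) ` L - (\<lambda>x. (1 - r) *\<^sub>R x + 0) ` L"
      using B_inner B_outer by blast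
    show "(\<Union>j\<in>J. B j) \<in> sets lebesgue"
      by (auto simp: B_def intro!: sets.finite_UN \<open>finite J\<close>)
  qed (intro fmeasurable.Diff scaled_lmeas)
  also have "\<dots> = ((1 + r) ^ ?n - (1 - r) ^ ?n) * measure lebesgue L"
    using r inner_sub
    by (subst measurable_measure_Diff) (auto simp only: fmeasurableD scaled_lmeas measure_dilation left_diff_distrib)
  also have "\<dots> \<le> (2 * r * (real ?n * 2 ^ (?n - 1))) * (b * (R + 1) ^ ?n)"
  proof (rule mult_mono)
    show "(1 + r) ^ ?n - (1 - r) ^ ?n \<le> 2 * r * (real ?n * 2 ^ (?n - 1))"
      using r by (intro power_diff_shell_bound) auto
    have "measure lebesgue L \<le> measure lebesgue (cball (0::'a) (R + 1))"
      using L_R scaled_lmeas[of 1] by (intro measure_mono_fmeasurable) (auto simp: fmeasurableD)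
    then show "measure lebesgue L \<le> b * (R + 1) ^ ?n"
      using R ball_measure[of "R + 1" 0] by (simp add: measure_completion content_cball_conv_ball)
  qed (use r in auto)
  also have "\<dots> = b * (r * ((2 * (R + 1)) ^ ?n * real ?n))"
    unfolding power_mult_distrib using power_minus_mult[of ?n "2::real"] by (simp add: algebra_simps)
  finally have "real (card J) * r ^ ?n \<le> r * ((2 * (R + 1)) ^ ?n * real ?n)"
    using \<open>b > 0\<close> by (simp add: mult.left_commute)
  moreover have "r ^ ?n = r * r ^ (?n - 1)"
    by (simp add: power_eq_if)
  ultimately show ?thesis
    using r by (simp add: pos_le_divide_eq mult.left_commute)
qed

text \<open>
  The empty set is included because the maximal family chosen below is not known in advance to be
  nonempty.
\<close>
lemma strict_separation_unit:
  fixes W :: "'a::euclidean_space set"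
  assumes "finite W" "z \<notin> convex hull W"
  obtains u where "norm u = 1" "\<And>w. w \<in> W \<Longrightarrow> u \<bullet> w < u \<bullet> z"
proof (cases "W = {}")
  case True
  then show thesis
    using that norm_Basis SOME_Basis by blast
next
  case False
  have "closed (convex hull W)"
    using assms(1) by (simp add: compact_imp_closed finite_imp_compact_convex_hull)
  then obtain a b where a: "a \<bullet> z < b" "\<And>x. x \<in> convex hull W \<Longrightarrow> b < a \<bullet> x"
    using separating_hyperplane_closed_point[of "convex hull W" z] assms(2) by auto
  have less: "a \<bullet> z < a \<bullet> w" if "w \<in> W" for w
    using a(1) a(2)[of w] that by (meson hull_inc less_trans)
  with False have "a \<noteq> 0" by auto
  show thesis
  proof (rule that[of "(- 1 / norm a) *\<^sub>R a"])
    show "norm ((- 1 / norm a) *\<^sub>R a) = 1"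
      using \<open>a \<noteq> 0\<close> by simp
    show "((- 1 / norm a) *\<^sub>R a) \<bullet> w < ((- 1 / norm a) *\<^sub>R a) \<bullet> z" if "w \<in> W" for w
      using less[OF that] \<open>a \<noteq> 0\<close> by (simp add: divide_strict_right_mono)
  qed
qed

text \<open>
  A largest family of pairs (point of \<open>V\<close>, unit direction in which it is maximal) with the points \<open>v + u\<close>
  pairwise \<open>2r\<close> apart has boundedly many members by the packing bound; \<open>W\<close> is the set of first
  components.  If \<open>(1 - 2r^2) x\<close> were outside \<open>convex hull W\<close>, a separating direction \<open>u\<close> and a point \<open>v \<in> V\<close>
  maximal for \<open>u\<close> would satisfy \<open>u \<bullet> w + 2r^2 < u \<bullet> v\<close> for all \<open>w \<in> W\<close>.  When \<open>w\<close> is maximal for \<open>t\<close>,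
  expanding the square gives \<open>dist (v + u) (w + t)^2 \<ge> 2 (u \<bullet> v - u \<bullet> w) + 2 (t \<bullet> w - t \<bullet> v) > 4r^2\<close>,
  so \<open>(v, u)\<close> could be added to the family.
\<close>
lemma sparse_approximating_subset_normalized:
  fixes V :: "'a::euclidean_space set"
  assumes V: "finite V" "V \<subseteq> cball 0 R" "cball 0 1 \<subseteq> convex hull V"
    and r: "0 < r" "r \<le> 1/2"
  obtains W where "W \<subseteq> V"
    "real (card W) \<le> (2 * (R + 1)) ^ DIM('a) * real DIM('a) / r ^ (DIM('a) - 1)"
    "\<And>x. x \<in> convex hull V \<Longrightarrow> (1 - 2 * r\<^sup>2) *\<^sub>R x \<in> convex hull W"
proof -
  define good where "good J \<longleftrightarrow> finite J \<and>
      (\<forall>(v, u)\<in>J. v \<in> V \<and> norm u = 1 \<and> (\<forall>w\<in>V. u \<bullet> w \<le> u \<bullet> v)) \<and>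
      (\<forall>(v, u)\<in>J. \<forall>(v', u')\<in>J. (v, u) \<noteq> (v', u') \<longrightarrow> 2 * r \<le> dist (v + u) (v' + u'))"
    for J :: "('a \<times> 'a) set"
  define M where "M = (2 * (R + 1)) ^ DIM('a) * real DIM('a) / r ^ (DIM('a) - 1)"
  have "0 \<in> convex hull V"
    using V(3) by auto
  then have card_le: "real (card J) \<le> M" if "good J" for J
    unfolding M_def using that r V(2)
    by (intro outer_parallel_packing[of V R J r]) (auto simp: good_def)
  have "good {}"
    by (simp add: good_def)
  moreover have "\<forall>J. good J \<longrightarrow> card J < nat \<lceil>M\<rceil> + 1"
    using card_le by (metis add.commute le_imp_less_Suc of_nat_le_iff order.trans plus_1_eq_Suc real_nat_ceiling_ge)
  ultimately obtain J where J: "good J" and J_max: "\<And>J'. good J' \<Longrightarrow> card J' \<le> card J"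
    using ex_has_greatest_nat[of good "{}" card "nat \<lceil>M\<rceil> + 1"] by auto
  show thesis
  proof (rule that[of "fst ` J"])
    show "fst ` J \<subseteq> V"
      using J by (auto simp: good_def)
    have "card (fst ` J) \<le> card J"
      using J by (simp add: card_image_le good_def)
    with card_le[OF J] show "real (card (fst ` J)) \<le> (2 * (R + 1)) ^ DIM('a) * real DIM('a) / r ^ (DIM('a) - 1)"
      by (simp add: M_def)
    fix x assume x: "x \<in> convex hull V"
    show "(1 - 2 * r\<^sup>2) *\<^sub>R x \<in> convex hull (fst ` J)"
    proof (rule ccontr)
      assume "(1 - 2 * r\<^sup>2) *\<^sub>R x \<notin> convex hull (fst ` J)"
      then obtain u where u: "norm u = 1"
        and u_sep: "\<And>w. w \<in> fst ` J \<Longrightarrow> u \<bullet> w < u \<bullet> ((1 - 2 * r\<^sup>2) *\<^sub>R x)"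
        using strict_separation_unit[of "fst ` J" "(1 - 2 * r\<^sup>2) *\<^sub>R x"] J by (auto simp: good_def)
      have "V \<noteq> {}"
        using x by auto
      then have "Max ((\<bullet>) u ` V) \<in> (\<bullet>) u ` V"
        using \<open>finite V\<close> by (intro Max_in) auto
      then obtain v where "v \<in> V" "u \<bullet> v = Max ((\<bullet>) u ` V)"
        by force
      then have v: "v \<in> V" "\<And>w. w \<in> V \<Longrightarrow> u \<bullet> w \<le> u \<bullet> v"
        using \<open>finite V\<close> by auto
      have "V \<subseteq> {y. u \<bullet> y \<le> u \<bullet> v}"
        using v by auto
      then have hull: "convex hull V \<subseteq> {y. u \<bullet> y \<le> u \<bullet> v}"
        by (simp add: convex_halfspace_le subset_hull)
      \<comment> \<open>Since the unit ball lies in the hull, a factor \<open>1 - 2r^2\<close> costs at least \<open>2r^2\<close> in every direction.\<close>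
      have "u \<in> convex hull V"
        using V(3) u by auto
      then have "1 \<le> u \<bullet> v"
        using hull u by (auto simp: norm_eq_1)
      have r2: "2 * r\<^sup>2 \<le> 1"
        using r power_mono[of r "1/2" 2] by (simp add: power2_eq_square)
      have gap: "u \<bullet> w + 2 * r\<^sup>2 < u \<bullet> v" if "w \<in> fst ` J" for w
      proof -
        have "u \<bullet> w < (1 - 2 * r\<^sup>2) * (u \<bullet> x)"
          using u_sep[OF that] by simp
        also have "\<dots> \<le> (1 - 2 * r\<^sup>2) * (u \<bullet> v)"
          using hull x r2 by (intro mult_left_mono) auto
        also have "\<dots> \<le> u \<bullet> v - 2 * r\<^sup>2"
          using mult_left_mono[OF \<open>1 \<le> u \<bullet> v\<close>, of "2 * r\<^sup>2"] by (simp add: left_diff_distrib)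
        finally show ?thesis by simp
      qed
      have far: "2 * r \<le> dist (v + u) (w + t)" if "(w, t) \<in> J" for w t
      proof -
        have "t \<bullet> v \<le> t \<bullet> w"
          using that J v(1) by (auto simp: good_def)
        moreover have "u \<bullet> w + 2 * r\<^sup>2 < u \<bullet> v"
          using gap[of w] that by force
        moreover have "(dist (v + u) (w + t))\<^sup>2 = (norm (v - w))\<^sup>2 + (norm (u - t))\<^sup>2
            + 2 * (u \<bullet> v - u \<bullet> w) + 2 * (t \<bullet> w - t \<bullet> v)"
          by (simp add: dist_norm power2_norm_eq_inner algebra_simps inner_commute)
        ultimately have "(2 * r)\<^sup>2 \<le> (dist (v + u) (w + t))\<^sup>2"
          by (simp add: power_mult_distrib add_increasing) (smt (verit) zero_le_power2)
        then show ?thesis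
          by (rule power2_le_imp_le) simp
      qed
      have "v \<notin> fst ` J"
        using gap[of v] by auto
      then have "(v, u) \<notin> J"
        by force
      moreover have "good (insert (v, u) J)"
        using J u v far unfolding good_def by (auto simp: dist_commute)
      ultimately show False
        using J_max[of "insert (v, u) J"] J by (auto simp: good_def)
    qed
  qed
qed

section \<open>Frames and affine normalization\<close>

lemma frame_combination_in_convex:
  fixes f :: "'i::finite \<Rightarrow> 'a::real_vector"
  assumes "convex C" "v \<in> C" "\<And>j. f j \<in> C"
    and c: "\<And>j. 0 \<le> c j" "(\<Sum>j\<in>UNIV. c j) \<le> 1"
  shows "v + (\<Sum>j\<in>UNIV. c j *\<^sub>R (f j - v)) \<in> C"
proof -
  define s where "s = (\<Sum>j\<in>UNIV. c j)"
  have eq: "v + (\<Sum>j\<in>UNIV. c j *\<^sub>R (f j - v)) = (1 - s) *\<^sub>R v + (\<Sum>j\<in>UNIV. c j *\<^sub>R f j)"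
    by (simp add: s_def scaleR_diff_right scaleR_diff_left sum_subtractf scaleR_sum_left)
  show ?thesis
  proof (cases "s = 0")
    case True
    then have "c j = 0" for j
      using c(1) by (simp add: s_def sum_nonneg_eq_0_iff)
    then show ?thesis
      using assms(2) by simp
  next
    case False
    then have s: "0 < s" "s \<le> 1"
      using c sum_nonneg[of UNIV c] by (auto simp: s_def less_le)
    have "(\<Sum>j\<in>UNIV. (c j / s) *\<^sub>R f j) \<in> C"
      using assms s by (intro convex_sum) (auto simp: s_def simp flip: sum_divide_distrib)
    then have "(1 - s) *\<^sub>R v + s *\<^sub>R (\<Sum>j\<in>UNIV. (c j / s) *\<^sub>R f j) \<in> C"
      using assms(1,2) s by (intro convexD) auto
    then show ?thesis
      using s by (simp add: eq scaleR_right.sum)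
  qed
qed

lemma exists_nonsingular_frame:
  fixes S :: "(real ^ 'n) set"
  assumes "\<And>a. a \<noteq> 0 \<Longrightarrow> \<exists>x\<in>S. a \<bullet> (x - v) \<noteq> 0"
  obtains f :: "'n \<Rightarrow> real ^ 'n" where "range f \<subseteq> S" "det (\<chi> i j. (f j - v) $ i) \<noteq> 0"
proof -
  let ?T = "(\<lambda>x. x - v) ` S"
  have "dim ?T = CARD('n)"
  proof (rule ccontr)
    assume "dim ?T \<noteq> CARD('n)"
    then have "dim ?T < DIM(real ^ 'n)"
      using dim_subset_UNIV[of ?T] by simp
    then obtain a where "a \<noteq> 0" "span ?T \<subseteq> {x. a \<bullet> x = 0}"
      using lowdim_subset_hyperplane by blast
    then show False
      using assms[of a] span_base[of _ ?T] by blast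
  qed
  then obtain B where B: "B \<subseteq> ?T" "independent B" "?T \<subseteq> span B" "card B = CARD('n)"
    using basis_exists[of ?T] by metis
  have "finite B"
    using B(2) by (rule independent_imp_finite)
  then obtain g where g: "bij_betw g (UNIV :: 'n set) B"
    using finite_same_card_bij[of "UNIV :: 'n set" B] B(4) by auto
  define M where "M = (\<chi> i j. g j $ i)"
  have "g j \<in> ?T" for j
    using g B(1) by (auto simp: bij_betw_def)
  then have "\<forall>j. \<exists>x. x \<in> S \<and> x - v = g j"
    by (metis imageE)
  then obtain f where f: "\<And>j. f j \<in> S" "\<And>j. f j - v = g j"
    by metis
  have col: "column j M = g j" for j
    by (simp add: column_def M_def vec_eq_iff)
  have "g j \<in> range ((*v) M)" for j
    using matrix_vector_mult_basis[of M j] col by (metis rangeI)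
  then have "span B \<subseteq> range ((*v) M)"
    using g by (intro span_minimal linear_subspace_image) (auto simp: bij_betw_def)
  moreover have "span B = UNIV"
    using B(2,4) by (simp add: indep_card_eq_dim_span dim_eq_full[symmetric])
  ultimately have "surj ((*v) M)"
    by auto
  then have "inj ((*v) M)"
    by (intro linear_surjective_imp_injective) auto
  then have "det M \<noteq> 0"
    using det_nz_iff_inj[of "(*v) M"] by simp
  moreover have "M = (\<chi> i j. (f j - v) $ i)"
    unfolding M_def f(2) ..
  moreover have "range f \<subseteq> S"
    using f(1) by blast
  ultimately show thesis
    using that[of f] by simp
qed


text \<open>
  A frame is a base point with \<open>d\<close> further points such that the difference vectors form a basis; it
  exists because a hyperplane containing \<open>V\<close> would contain the hull.  Its determinant is \<open>d!\<close> times the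
  signed volume of the simplex that it spans.
\<close>
lemma full_dimensional_frame:
  fixes V :: "(real ^ 'n) set"
  assumes "full_dimensional (convex hull V)"
  obtains v and f :: "'n \<Rightarrow> real ^ 'n"
  where "v \<in> V" "range f \<subseteq> V" "det (\<chi> i j. (f j - v) $ i) \<noteq> 0"
proof -
  have not_hyperplane: "\<not> V \<subseteq> {x. a \<bullet> x = b}" if "a \<noteq> 0" for a b
    using assms that hull_minimal[of V "{x. a \<bullet> x = b}" convex] convex_hyperplane[of a b]
    unfolding full_dimensional_def by blast
  have "V \<noteq> {}"
    using not_hyperplane[of "axis undefined 1"] by auto
  then obtain v where "v \<in> V"
    by auto
  have "\<exists>x\<in>V. a \<bullet> (x - v) \<noteq> 0" if "a \<noteq> 0" for a
    using not_hyperplane[OF that, of "a \<bullet> v"] by (auto simp: inner_diff_right)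
  then obtain f :: "'n \<Rightarrow> real ^ 'n" where "range f \<subseteq> V" "det (\<chi> i j. (f j - v) $ i) \<noteq> 0"
    by (rule exists_nonsingular_frame[of V v])
  with \<open>v \<in> V\<close> show thesis
    by (rule that)
qed

text \<open>
  Fix \<open>v \<in> V\<close> and choose points \<open>f j\<close> of \<open>V\<close> that maximize the absolute value of the determinant of
  the vectors \<open>f j - v\<close>.  In the coordinates of this frame the hull contains the standard simplex, hence
  the cube \<open>[0, 1/d]^d\<close>, and by Cramer's rule every point of \<open>V\<close> has coordinates in \<open>[-1, 1]\<close>: each coordinate
  is the quotient of a competing determinant by the maximal one.  Moving the centre of the cube to the
  origin and scaling by \<open>2d\<close> gives the two balls.
\<close>
lemma normalizing_affine_map:
  fixes V :: "(real ^ 'n) set"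
  assumes V: "finite V" "full_dimensional (convex hull V)"
  obtains g :: "real ^ 'n \<Rightarrow> real ^ 'n" and c where "linear g" "inj g"
    "cball 0 1 \<subseteq> convex hull ((\<lambda>x. g (x - c)) ` V)"
    "(\<lambda>x. g (x - c)) ` V \<subseteq> cball 0 (real CARD('n) * (2 * real CARD('n) + 1))"
proof -
  let ?n = "real CARD('n)"
  obtain v and f0 :: "'n \<Rightarrow> real ^ 'n"
    where v: "v \<in> V" "range f0 \<subseteq> V" "det (\<chi> i j. (f0 j - v) $ i) \<noteq> 0"
    by (rule full_dimensional_frame[OF V(2)])
  define D where "D f = \<bar>det (\<chi> i j. (f j - v) $ i)\<bar>" for f :: "'n \<Rightarrow> real ^ 'n"
  have f0: "range f0 \<subseteq> V" "D f0 > 0" and "v \<in> V"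
    using v by (auto simp: D_def)
  define FF where "FF = {f :: 'n \<Rightarrow> real ^ 'n. range f \<subseteq> V}"
  have "FF = (UNIV \<rightarrow>\<^sub>E V)"
    by (auto simp: FF_def PiE_def)
  then have "finite FF"
    using V(1) by (simp add: finite_PiE)
  then have "Max (D ` FF) \<in> D ` FF"
    using f0(1) by (intro Max_in) (auto simp: FF_def)
  then obtain f where "f \<in> FF" "D f = Max (D ` FF)"
    by force
  then have f: "range f \<subseteq> V" and f_max: "\<And>f'. range f' \<subseteq> V \<Longrightarrow> D f' \<le> D f"
    using \<open>finite FF\<close> by (auto simp: FF_def)
  define M where "M = (\<chi> i j. (f j - v) $ i)"
  have M_sum: "M *v y = (\<Sum>j\<in>UNIV. y $ j *\<^sub>R (f j - v))" for y
    by (simp add: M_def vec_eq_iff matrix_vector_mult_def mult.commute)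
  have detM: "det M \<noteq> 0" "D f = \<bar>det M\<bar>"
    using f_max[OF f0(1)] f0(2) by (auto simp: D_def M_def)
  then obtain B where B: "M ** B = mat 1" "B ** M = mat 1"
    by (metis invertible_def invertible_det_nz)
  have BM: "B *v (M *v y) = y" for y
    by (simp add: matrix_vector_mul_assoc B)
  define h :: "real ^ 'n" where "h = (\<chi> i. 1 / (2 * ?n))"
  define c where "c = v + M *v h"
  define g where "g x = (2 * ?n) *\<^sub>R (B *v x)" for x
  have g_frame: "g (v + M *v y - c) = (2 * ?n) *\<^sub>R (y - h)" for y
    by (simp add: g_def c_def BM flip: matrix_vector_mult_diff_distrib)
  have "linear g"
    unfolding g_def by (intro linear_compose_scale_right) auto
  have "inj g"
  proof (rule injI)
    fix x y assume "g x = g y"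
    then have "M *v (B *v x) = M *v (B *v y)"
      by (simp add: g_def)
    then show "x = y"
      by (simp add: matrix_vector_mul_assoc B)
  qed
  have "(\<lambda>x. g (x - c)) ` V \<subseteq> cball 0 (?n * (2 * ?n + 1))"
  proof clarsimp
    fix w assume "w \<in> V"
    define y where "y = (\<chi> k. det (\<chi> i j. if j = k then (w - v) $ i else M $ i $ j) / det M)"
    have y: "M *v y = w - v"
      using cramer[OF detM(1)] y_def by blast
    have "\<bar>y $ k\<bar> \<le> 1" for k
    proof -
      have "(\<chi> i j. if j = k then (w - v) $ i else M $ i $ j) = (\<chi> i j. ((f(k := w)) j - v) $ i)"
        by (simp add: M_def vec_eq_iff)
      then have "\<bar>y $ k\<bar> = D (f(k := w)) / D f"
        by (simp add: y_def D_def detM M_def abs_divide)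
      also have "\<dots> \<le> 1"
      proof -
        have "D (f(k := w)) \<le> D f"
          using f \<open>w \<in> V\<close> by (intro f_max) auto
        then show ?thesis
          using detM by simp
      qed
      finally show ?thesis .
    qed
    then have "\<bar>y $ k - 1 / (2 * ?n)\<bar> \<le> 1 + 1 / (2 * ?n)" for k
      by (intro order.trans[OF abs_triangle_ineq4] add_mono) auto
    then have "(2 * ?n) * \<bar>y $ k - 1 / (2 * ?n)\<bar> \<le> (2 * ?n) * (1 + 1 / (2 * ?n))" for k
      by (intro mult_left_mono) auto
    then have coord: "\<bar>((2 * ?n) *\<^sub>R (y - h)) $ k\<bar> \<le> 2 * ?n + 1" for k
      by (simp add: h_def abs_mult distrib_left)
    have "g (w - c) = (2 * ?n) *\<^sub>R (y - h)"
      using g_frame[of y] y by simp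
    then have "norm (g (w - c)) \<le> (\<Sum>k\<in>UNIV. \<bar>((2 * ?n) *\<^sub>R (y - h)) $ k\<bar>)"
      by (metis norm_le_l1_cart)
    also have "\<dots> \<le> (\<Sum>k\<in>(UNIV :: 'n set). 2 * ?n + 1)"
      by (intro sum_mono coord)
    finally show "norm (g (w - c)) \<le> ?n * (2 * ?n + 1)"
      by simp
  qed
  moreover have "cball 0 1 \<subseteq> convex hull ((\<lambda>x. g (x - c)) ` V)"
  proof
    fix y :: "real ^ 'n" assume "y \<in> cball 0 1"
    then have y: "\<bar>y $ j\<bar> \<le> 1" for j
      using component_le_norm_cart[of y j] by simp
    define x where "x = (1 / (2 * ?n)) *\<^sub>R y + h"
    have x: "0 \<le> x $ j" "x $ j \<le> 1 / ?n" for j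
      using y[of j] by (auto simp: x_def h_def field_simps abs_le_iff)
    have "(\<Sum>j\<in>UNIV. x $ j) \<le> (\<Sum>j\<in>(UNIV :: 'n set). 1 / ?n)"
      using x by (intro sum_mono) auto
    then have "v + M *v x \<in> convex hull V"
      unfolding M_sum using f x \<open>v \<in> V\<close> by (intro frame_combination_in_convex) (auto intro: hull_inc)
    moreover have "y = g (v + M *v x - c)"
      by (simp add: g_frame x_def)
    ultimately have "y \<in> g ` (\<lambda>x. - c + 1 *\<^sub>R x) ` (convex hull V)"
      by (auto simp: image_iff)
    also have "\<dots> = convex hull (g ` (\<lambda>x. - c + 1 *\<^sub>R x) ` V)"
      by (simp only: convex_hull_affinity convex_hull_linear_image[OF \<open>linear g\<close>, symmetric])
    finally show "y \<in> convex hull ((\<lambda>x. g (x - c)) ` V)"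
      by (simp add: image_image)
  qed
  ultimately show thesis
    using that[of g c] \<open>linear g\<close> \<open>inj g\<close> by blast
qed

text \<open>
  The normalizing map carries the assertion over from the normalized case; the homothety with ratio
  \<open>1 - 2r^2\<close> about the preimage of the origin becomes a translate of a scaled copy.
\<close>
lemma sparse_approximating_subset:
  fixes V :: "(real ^ 'n) set"
  assumes V: "finite V" "full_dimensional (convex hull V)" and r: "0 < r" "r \<le> 1/2"
  obtains W c where "W \<subseteq> V"
    "real (card W) \<le> (2 * (real CARD('n) * (2 * real CARD('n) + 1) + 1)) ^ CARD('n) * real CARD('n) / r ^ (CARD('n) - 1)"
    "\<And>x. x \<in> convex hull V \<Longrightarrow> (1 - 2 * r\<^sup>2) *\<^sub>R x + c \<in> convex hull W"
proof -
  obtain g :: "real ^ 'n \<Rightarrow> real ^ 'n" and c where g: "linear g" "inj g" "cball 0 1 \<subseteq> convex hull ((\<lambda>x. g (x - c)) ` V)"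
    "(\<lambda>x. g (x - c)) ` V \<subseteq> cball 0 (real CARD('n) * (2 * real CARD('n) + 1))"
    by (rule normalizing_affine_map[OF V])
  define T where "T x = g (x - c)" for x
  have hull_T: "convex hull (T ` S) = T ` (convex hull S)" for S
  proof -
    have T: "T ` A = g ` (\<lambda>x. - c + 1 *\<^sub>R x) ` A" for A
      by (simp add: T_def image_image)
    show ?thesis
      by (simp only: T convex_hull_affinity convex_hull_linear_image[OF g(1), symmetric])
  qed
  have "inj T"
  proof (rule injI)
    fix x y assume "T x = T y"
    then have "x - c = y - c"
      unfolding T_def by (rule injD[OF g(2)])
    then show "x = y"
      by simp
  qed
  obtain W' where W': "W' \<subseteq> T ` V"
    "real (card W') \<le> (2 * (real CARD('n) * (2 * real CARD('n) + 1) + 1)) ^ DIM(real ^ 'n) * real DIM(real ^ 'n) / r ^ (DIM(real ^ 'n) - 1)"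
    "\<And>x. x \<in> convex hull (T ` V) \<Longrightarrow> (1 - 2 * r\<^sup>2) *\<^sub>R x \<in> convex hull W'"
    using sparse_approximating_subset_normalized[of "T ` V" "real CARD('n) * (2 * real CARD('n) + 1)" r] g(3,4) V(1) r
    unfolding T_def by (metis finite_imageI)
  obtain W where W: "W \<subseteq> V" "W' = T ` W"
    using W'(1) by (meson subset_imageE)
  show thesis
  proof (rule that[OF W(1), of "(2 * r\<^sup>2) *\<^sub>R c"])
    show "real (card W) \<le> (2 * (real CARD('n) * (2 * real CARD('n) + 1) + 1)) ^ CARD('n) * real CARD('n) / r ^ (CARD('n) - 1)"
      using W'(2) W(2) \<open>inj T\<close> by (simp add: card_image inj_on_subset)
    fix x assume x: "x \<in> convex hull V"
    have "T ((1 - 2 * r\<^sup>2) *\<^sub>R x + (2 * r\<^sup>2) *\<^sub>R c) = g ((1 - 2 * r\<^sup>2) *\<^sub>R (x - c))"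
      by (simp add: T_def algebra_simps)
    also have "\<dots> = (1 - 2 * r\<^sup>2) *\<^sub>R T x"
      by (simp add: T_def linear_scale[OF g(1)])
    also have "\<dots> \<in> convex hull W'"
      using x by (intro W'(3)) (simp add: hull_T)
    finally show "(1 - 2 * r\<^sup>2) *\<^sub>R x + (2 * r\<^sup>2) *\<^sub>R c \<in> convex hull W"
      using \<open>inj T\<close> by (simp add: W(2) hull_T inj_image_mem_iff)
  qed
qed

section \<open>Volume gained by adding a lattice point\<close>

lemma finite_bounded_integer_lattice:
  "finite {z :: real ^ 'n. z \<in> integer_lattice \<and> norm z \<le> R}"
proof -
  define K where "K = {-\<lceil>R\<rceil>..\<lceil>R\<rceil>}"
  let ?F = "(\<lambda>f. \<chi> i. real_of_int (f i)) ` (PiE (UNIV :: 'n set) (\<lambda>_. K))"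
  have "z \<in> ?F" if z: "z \<in> integer_lattice" "norm z \<le> R" for z :: "real ^ 'n"
  proof (rule image_eqI)
    show "z = (\<chi> i. of_int \<lfloor>z $ i\<rfloor>)"
      using z(1) by (simp add: integer_lattice_def vec_eq_iff)
    have "\<lfloor>z $ i\<rfloor> \<in> K" for i
    proof -
      have "\<bar>z $ i\<bar> \<le> R"
        using component_le_norm_cart[of z i] z(2) by linarith
      then have "of_int (- \<lceil>R\<rceil>) \<le> z $ i" "z $ i < of_int (\<lceil>R\<rceil> + 1)"
        using le_of_int_ceiling[of R] unfolding of_int_minus of_int_add of_int_1 by linarith+
      then have "- \<lceil>R\<rceil> \<le> \<lfloor>z $ i\<rfloor>" "\<lfloor>z $ i\<rfloor> < \<lceil>R\<rceil> + 1"
        by (simp_all only: le_floor_iff floor_less_iff)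
      then show ?thesis
        by (simp add: K_def)
    qed
    then show "(\<lambda>i. \<lfloor>z $ i\<rfloor>) \<in> PiE UNIV (\<lambda>_. K)"
      by (intro PiE_I) simp_all
  qed
  then have "{z :: real ^ 'n. z \<in> integer_lattice \<and> norm z \<le> R} \<subseteq> ?F"
    by blast
  moreover have "finite ?F"
    by (intro finite_imageI finite_PiE) (simp_all add: K_def)
  ultimately show ?thesis
    by (rule finite_subset)
qed

text \<open>
  Cut the half-open unit cube \<open>Q\<close> by the translates of \<open>S\<close> and move the pieces back into \<open>S\<close>: they stay
  disjoint because distinct integer translates of \<open>Q\<close> are disjoint.
\<close>
lemma lattice_covering_measure_ge_1:
  fixes S :: "(real ^ 'n) set"
  assumes "bounded S" "S \<in> sets lebesgue"
    and cover: "\<And>x. \<exists>z\<in>integer_lattice. x - z \<in> S"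
  shows "1 \<le> measure lebesgue S"
proof -
  define Q where "Q = {x :: real ^ 'n. \<forall>i. 0 \<le> x $ i \<and> x $ i < 1}"
  have "convex Q"
    unfolding Q_def convex_alt
  proof (intro ballI allI impI CollectI)
    fix x y :: "real ^ 'n" and t :: real and i
    assume x: "x \<in> {x. \<forall>i. 0 \<le> x $ i \<and> x $ i < 1}" and y: "y \<in> {x. \<forall>i. 0 \<le> x $ i \<and> x $ i < 1}"
      and t: "0 \<le> t \<and> t \<le> 1"
    have "(1 - t) * x $ i + t * y $ i < 1"
      using x y t by (intro convex_bound_lt) auto
    then show "0 \<le> ((1 - t) *\<^sub>R x + t *\<^sub>R y) $ i \<and> ((1 - t) *\<^sub>R x + t *\<^sub>R y) $ i < 1"
      using x y t by simp
  qed
  have Q_sub: "Q \<subseteq> cbox 0 1" and box_sub: "box 0 1 \<subseteq> Q"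
    by (auto simp: Q_def mem_box_cart less_imp_le)
  have "bounded Q"
    using Q_sub bounded_cbox bounded_subset by blast
  have Q: "Q \<in> lmeasurable"
    using \<open>convex Q\<close> \<open>bounded Q\<close> by (rule measurable_convex)
  have S: "S \<in> lmeasurable"
    using assms by (simp add: bounded_set_imp_lmeasurable)
  have "1 = measure lebesgue (cbox 0 (1 :: real ^ 'n))"
    by (simp add: measure_completion content_cbox_if_cart interval_eq_empty_cart)
  also have "\<dots> = measure lebesgue (box 0 (1 :: real ^ 'n))"
    by (simp add: measure_completion measure_lborel_box_eq measure_lborel_cbox_eq)
  also have "\<dots> \<le> measure lebesgue Q"
    using box_sub Q by (intro measure_mono_fmeasurable) auto
  finally have "1 \<le> measure lebesgue Q" .
  obtain a b where ab: "\<And>x. x \<in> Q \<Longrightarrow> norm x \<le> a" "\<And>x. x \<in> S \<Longrightarrow> norm x \<le> b"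
    using \<open>bounded Q\<close> \<open>bounded S\<close> by (auto simp: bounded_iff)
  define Z where "Z = {z :: real ^ 'n. z \<in> integer_lattice \<and> norm z \<le> a + b}"
  have "finite Z"
    unfolding Z_def by (rule finite_bounded_integer_lattice)
  define A where "A z = (+) (- z) ` Q \<inter> S" for z
  have A: "A z \<in> lmeasurable" for z
    unfolding A_def using Q S by (intro fmeasurable.Int measurable_translation)
  have "Q \<subseteq> (\<Union>z\<in>Z. (+) z ` A z)"
  proof
    fix x assume x: "x \<in> Q"
    obtain z where z: "z \<in> integer_lattice" "x - z \<in> S"
      using cover by blast
    have "norm z \<le> norm x + norm (x - z)"
      using norm_triangle_ineq4[of x "x - z"] by simp
    then have "z \<in> Z"
      using ab(1)[OF x] ab(2)[OF z(2)] z by (simp add: Z_def)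
    moreover have "x \<in> (+) z ` A z"
      using x z by (intro image_eqI[of _ _ "x - z"]) (auto simp: A_def image_iff)
    ultimately show "x \<in> (\<Union>z\<in>Z. (+) z ` A z)"
      by blast
  qed
  then have "measure lebesgue Q \<le> measure lebesgue (\<Union>z\<in>Z. (+) z ` A z)"
    using Q A \<open>finite Z\<close>
    by (intro measure_mono_fmeasurable) (auto intro!: fmeasurable.finite_UN measurable_translation dest: fmeasurableD)
  also have "\<dots> \<le> (\<Sum>z\<in>Z. measure lebesgue ((+) z ` A z))"
    using A \<open>finite Z\<close> by (intro measure_UNION_le) (auto intro!: fmeasurableD measurable_translation)
  also have "\<dots> = (\<Sum>z\<in>Z. measure lebesgue (A z))"
    by (simp add: measure_translation)
  also have "\<dots> = measure lebesgue (\<Union>z\<in>Z. A z)"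
  proof (rule measure_UNION'[symmetric])
    have "z = z'" if "x \<in> A z" "x \<in> A z'" "z \<in> Z" "z' \<in> Z" for x z z'
    proof -
      have "z $ i = z' $ i" for i
      proof -
        have "x + w \<in> Q" if "x \<in> A w" for w
          using that by (auto simp: A_def)
        then have "x + z \<in> Q" "x + z' \<in> Q"
          using that by blast+
        then have "0 \<le> x $ i + z $ i" "x $ i + z $ i < 1" "0 \<le> x $ i + z' $ i" "x $ i + z' $ i < 1"
          by (auto simp: Q_def)
        then have "\<bar>z $ i - z' $ i\<bar> < 1"
          by linarith
        moreover have "z $ i \<in> \<int>" "z' $ i \<in> \<int>"
          using that by (auto simp: Z_def integer_lattice_def)
        ultimately show ?thesis
          by (simp add: Ints_eq_abs_less1)
      qed
      then show ?thesis
        by (simp add: vec_eq_iff)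
    qed
    then show "pairwise (\<lambda>y z. disjnt (A y) (A z)) Z"
      unfolding pairwise_def disjnt_def by blast
  qed (use A \<open>finite Z\<close> in auto)
  also have "\<dots> \<le> measure lebesgue S"
  proof (rule measure_mono_fmeasurable)
    show "(\<Union>z\<in>Z. A z) \<in> sets lebesgue"
      using A \<open>finite Z\<close> by (intro sets.finite_UN) (auto intro: fmeasurableD)
  qed (use S in \<open>auto simp: A_def\<close>)
  finally show ?thesis
    using \<open>1 \<le> measure lebesgue Q\<close> by linarith
qed

text \<open>
  The integer translates of the parallelepiped spanned by the edge vectors at \<open>v\<close> cover the space (take
  integer parts of coordinates), so its volume is at least one.  Shrunk by the factor \<open>d\<close> it fits into
  the simplex.
\<close>
lemma lattice_simplex_measure_ge:
  fixes f :: "'n \<Rightarrow> real ^ 'n"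
  assumes lat: "v \<in> integer_lattice" "range f \<subseteq> integer_lattice"
    and det: "det (\<chi> i j. (f j - v) $ i) \<noteq> 0"
  shows "1 / real CARD('n) ^ CARD('n) \<le> measure lebesgue (convex hull (insert v (range f)))"
proof -
  let ?n = "real CARD('n)"
  define M where "M = (\<chi> i j. (f j - v) $ i)"
  let ?S = "(*v) M ` cbox 0 1"
  let ?T = "convex hull (insert v (range f))"
  have M_sum: "M *v y = (\<Sum>j\<in>UNIV. y $ j *\<^sub>R (f j - v))" for y
    by (simp add: M_def vec_eq_iff matrix_vector_mult_def mult.commute)
  have compact: "compact ?S"
    by (intro compact_continuous_image compact_cbox linear_continuous_on matrix_vector_mul_bounded_linear)
  have "1 \<le> measure lebesgue ?S"
  proof (rule lattice_covering_measure_ge_1)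
    show "bounded ?S" "?S \<in> sets lebesgue"
      using compact by (auto simp: compact_imp_bounded compact_imp_closed lmeasurable_compact fmeasurableD)
    fix x
    obtain y where y: "M *v y = x"
      using det cramer[of M _ x] unfolding M_def by blast
    show "\<exists>z\<in>integer_lattice. x - z \<in> ?S"
    proof
      show "M *v (\<chi> j. of_int \<lfloor>y $ j\<rfloor>) \<in> integer_lattice"
        using lat unfolding integer_lattice_def M_def matrix_vector_mult_def
        by (auto intro!: Ints_sum Ints_mult Ints_diff)
      have "x - M *v (\<chi> j. of_int \<lfloor>y $ j\<rfloor>) = M *v (\<chi> j. frac (y $ j))"
        by (simp add: y[symmetric] matrix_vector_mult_diff_distrib[symmetric] frac_def)
           (simp add: minus_vec_def)
      then show "x - M *v (\<chi> j. of_int \<lfloor>y $ j\<rfloor>) \<in> ?S"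
        by (auto simp: mem_box_cart frac_lt_1 less_imp_le)
    qed
  qed
  also have "measure lebesgue ?S = ?n ^ CARD('n) * measure lebesgue ((\<lambda>x. (1 / ?n) *\<^sub>R x + v) ` ?S)"
    by (subst measure_dilation) (simp add: power_one_over)
  also have "\<dots> \<le> ?n ^ CARD('n) * measure lebesgue ?T"
  proof (intro mult_left_mono measure_mono_fmeasurable)
    show "(\<lambda>x. (1 / ?n) *\<^sub>R x + v) ` ?S \<subseteq> ?T"
    proof
      fix z assume "z \<in> (\<lambda>x. (1 / ?n) *\<^sub>R x + v) ` ?S"
      then obtain y where y: "y \<in> cbox 0 1" "z = (1 / ?n) *\<^sub>R (M *v y) + v"
        by blast
      have c: "0 \<le> y $ j / ?n" "y $ j / ?n \<le> 1 / ?n" for j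
        using y by (auto simp: mem_box_cart divide_right_mono)
      have "(\<Sum>j\<in>UNIV. y $ j / ?n) \<le> (\<Sum>j\<in>(UNIV::'n set). 1 / ?n)"
        using c by (intro sum_mono) auto
      then have "v + (\<Sum>j\<in>UNIV. (y $ j / ?n) *\<^sub>R (f j - v)) \<in> ?T"
        using c by (intro frame_combination_in_convex) (auto simp: hull_inc)
      then show "z \<in> ?T"
        by (simp add: y(2) M_sum scaleR_right.sum add.commute)
    qed
    show "(\<lambda>x. (1 / ?n) *\<^sub>R x + v) ` ?S \<in> sets lebesgue"
      by (intro fmeasurableD lmeasurable_compact compact_continuous_image[OF _ compact] continuous_intros)
    show "?T \<in> lmeasurable"
      by (intro lmeasurable_compact finite_imp_compact_convex_hull) auto
  qed auto
  finally show ?thesis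
    by (simp add: divide_le_eq mult.commute)
qed

text \<open>
  The segment from an interior point \<open>p\<close> to \<open>v\<close> leaves the polytope through some facet, and \<open>v\<close> lies
  strictly beyond the hyperplane of that facet.  A simplex with apex \<open>v\<close> and the other vertices in the
  facet then meets the polytope only inside this hyperplane, a null set.
\<close>
lemma lattice_point_adds_volume:
  fixes X :: "(real ^ 'n) set"
  assumes X: "finite X" "X \<subseteq> integer_lattice" "interior (convex hull X) \<noteq> {}"
    and v: "v \<in> integer_lattice" "v \<notin> convex hull X"
  shows "measure lebesgue (convex hull X) + 1 / real CARD('n) ^ CARD('n)
    \<le> measure lebesgue (convex hull (insert v X))"
proof -
  let ?K = "convex hull X"
  have "polyhedron ?K"
    using X(1) by (rule polyhedron_convex_hull)
  obtain p where p: "p \<in> interior ?K"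
    using X(3) by auto
  have "p \<in> ?K"
    using p interior_subset by blast
  have "closed_segment p v \<inter> frontier ?K \<noteq> {}"
    using \<open>p \<in> ?K\<close> v(2) by (intro connected_Int_frontier) auto
  then obtain y where y: "y \<in> closed_segment p v" "y \<in> frontier ?K"
    by auto
  have "frontier ?K = \<Union> {F. F facet_of ?K}"
    using rel_frontier_of_polyhedron[OF \<open>polyhedron ?K\<close>] X(3) rel_frontier_nonempty_interior by metis
  then obtain F where F: "F facet_of ?K" "y \<in> F"
    using y(2) by auto
  obtain a b where ab: "a \<noteq> 0" "?K \<subseteq> {x. a \<bullet> x \<le> b}" "F = ?K \<inter> {x. a \<bullet> x = b}"
    using facet_of_polyhedron[OF \<open>polyhedron ?K\<close> F(1)] .
  have "p \<in> interior {x. a \<bullet> x \<le> b}"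
    using p interior_mono[OF ab(2)] by blast
  then have "a \<bullet> p < b"
    using ab(1) by (simp add: interior_halfspace_le)
  have "a \<bullet> v > b"
  proof (rule ccontr)
    assume "\<not> a \<bullet> v > b"
    obtain t where t: "y = (1 - t) *\<^sub>R p + t *\<^sub>R v" "0 \<le> t" "t \<le> 1"
      using y(1) by (auto simp: closed_segment_def)
    have "y \<in> ?K"
      using F(2) ab(3) by auto
    then have "t < 1"
      using t v(2) by (cases "t = 1") auto
    then have "(1 - t) * (a \<bullet> p) < (1 - t) * b"
      using \<open>a \<bullet> p < b\<close> by simp
    moreover have "t * (a \<bullet> v) \<le> t * b"
      using \<open>\<not> a \<bullet> v > b\<close> t by (intro mult_left_mono) auto
    ultimately have "a \<bullet> y < b"
      by (simp add: t inner_add_right algebra_simps)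
    then show False
      using F(2) ab(3) by auto
  qed
  obtain X' where X': "X' \<subseteq> X" "F = convex hull X'"
    using face_of_convex_hull_subset[of X F] F(1) X(1) by (auto simp: facet_of_imp_face_of finite_imp_compact)
  have X'_hyp: "X' \<subseteq> {x. a \<bullet> x = b}"
    using hull_subset[of X' convex] ab(3) X'(2) by auto
  have "aff_dim ?K = CARD('n)"
    using aff_dim_nonempty_interior[OF X(3)] by simp
  then have "aff_dim X' = CARD('n) - 1"
    using F(1) X'(2) by (simp add: facet_of_def aff_dim_convex_hull)
  moreover have "v \<notin> affine hull X'"
  proof -
    have "affine hull X' \<subseteq> {x. a \<bullet> x = b}"
      using X'_hyp by (simp add: affine_hyperplane hull_minimal)
    then show ?thesis
      using \<open>a \<bullet> v > b\<close> by auto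
  qed
  ultimately have dim: "aff_dim (insert v X') = CARD('n)"
    by (simp add: aff_dim_insert)
  have "\<exists>x\<in>X'. a' \<bullet> (x - v) \<noteq> 0" if "a' \<noteq> 0" for a'
  proof (rule ccontr)
    assume "\<not> ?thesis"
    then have "insert v X' \<subseteq> {x. a' \<bullet> x = a' \<bullet> v}"
      by (auto simp: inner_diff_right)
    then have "aff_dim (insert v X') \<le> aff_dim {x. a' \<bullet> x = a' \<bullet> v}"
      by (rule aff_dim_subset)
    then show False
      using dim that by simp
  qed
  then obtain f :: "'n \<Rightarrow> real ^ 'n" where f: "range f \<subseteq> X'" "det (\<chi> i j. (f j - v) $ i) \<noteq> 0"
    using exists_nonsingular_frame[of X' v] by auto
  let ?T = "convex hull (insert v (range f))"
  have T_hyp: "?T \<subseteq> {x. a \<bullet> x \<ge> b}"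
    using f(1) X'_hyp \<open>a \<bullet> v > b\<close> by (intro hull_minimal) (auto simp: convex_halfspace_ge)
  have "?K \<inter> ?T \<subseteq> {x. a \<bullet> x = b}"
    using ab(2) T_hyp by fastforce
  then have "negligible (?K \<inter> ?T)"
    using negligible_hyperplane[of a b] ab(1) negligible_subset by blast
  have meas: "?K \<in> lmeasurable" "?T \<in> lmeasurable" "convex hull (insert v X) \<in> lmeasurable"
    using X(1) by (auto intro!: lmeasurable_compact finite_imp_compact_convex_hull)
  have "measure lebesgue ?K + 1 / real CARD('n) ^ CARD('n) \<le> measure lebesgue ?K + measure lebesgue ?T"
    using f X'(1) X(2) v(1) by (intro add_left_mono lattice_simplex_measure_ge) auto
  also have "\<dots> = measure lebesgue (?K \<union> ?T)"
    using meas \<open>negligible (?K \<inter> ?T)\<close> by (simp add: measure_Un3 negligible_imp_measure0)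
  also have "\<dots> \<le> measure lebesgue (convex hull (insert v X))"
  proof (rule measure_mono_fmeasurable)
    have "?T \<subseteq> convex hull (insert v X)"
      using f(1) X'(1) by (intro hull_mono) auto
    moreover have "?K \<subseteq> convex hull (insert v X)"
      by (intro hull_mono) auto
    ultimately show "?K \<union> ?T \<subseteq> convex hull (insert v X)"
      by simp
  qed (use meas in \<open>auto intro: fmeasurableD\<close>)
  finally show ?thesis .
qed

text \<open>
  Convex position guarantees that each vertex is still outside the hull of those added before it.
\<close>
lemma lattice_vertices_add_volume:
  fixes V :: "(real ^ 'n) set"
  assumes V: "finite V" "V \<subseteq> integer_lattice" "\<And>v. v \<in> V \<Longrightarrow> v \<notin> convex hull (V - {v})"
    and W: "W \<subseteq> V" "interior (convex hull W) \<noteq> {}"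
  shows "measure lebesgue (convex hull W) + real (card (V - W)) / real CARD('n) ^ CARD('n)
    \<le> measure lebesgue (convex hull V)"
proof -
  have "measure lebesgue (convex hull W) + real (card D) / real CARD('n) ^ CARD('n)
      \<le> measure lebesgue (convex hull (W \<union> D))" if "finite D" "D \<subseteq> V - W" for D
    using that
  proof (induction D rule: finite_induct)
    case (insert v D)
    have "finite (W \<union> D)"
      using W(1) V(1) insert.hyps finite_subset by auto
    moreover have "interior (convex hull (W \<union> D)) \<noteq> {}"
      using W(2) interior_mono[OF hull_mono[of W "W \<union> D" convex]] by auto
    moreover have "convex hull (W \<union> D) \<subseteq> convex hull (V - {v})"
      using W(1) insert.hyps insert.prems by (intro hull_mono) auto
    ultimately have "measure lebesgue (convex hull (W \<union> D)) + 1 / real CARD('n) ^ CARD('n)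
        \<le> measure lebesgue (convex hull (insert v (W \<union> D)))"
      using V W(1) insert.prems by (intro lattice_point_adds_volume) auto
    moreover have "measure lebesgue (convex hull W) + real (card D) / real CARD('n) ^ CARD('n)
        \<le> measure lebesgue (convex hull (W \<union> D))"
      using insert.prems by (intro insert.IH) auto
    ultimately show ?case
      using insert.hyps by (simp add: add_divide_distrib)
  qed simp
  from this[of "V - W"] show ?thesis
    using V(1) W(1) by (simp add: Un_absorb1)
qed


section \<open>Balancing the two estimates\<close>

lemma lattice_polytope_vert:
  fixes P :: "(real ^ 'n) set"
  assumes "lattice_polytope P"
  shows "P = convex hull (vert P)" "vert P \<subseteq> integer_lattice"
    "\<And>v. v \<in> vert P \<Longrightarrow> v \<notin> convex hull (vert P - {v})"
proof -
  obtain S where S: "finite S" "S \<subseteq> integer_lattice" "P = convex hull S"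
    using assms unfolding lattice_polytope_def by blast
  have "compact P" "convex P"
    using S by (auto intro: finite_imp_compact_convex_hull)
  then show hull: "P = convex hull (vert P)"
    unfolding vert_def by (rule Krein_Milman_Minkowski)
  show "vert P \<subseteq> integer_lattice"
    using S extreme_point_of_convex_hull unfolding vert_def by blast
  fix v assume "v \<in> vert P"
  then have "convex (P - {v})"
    using \<open>convex P\<close> by (simp add: vert_def extreme_point_of_stillconvex)
  moreover have "vert P - {v} \<subseteq> P - {v}"
    by (auto simp: vert_def extreme_point_of_def)
  ultimately have "convex hull (vert P - {v}) \<subseteq> P - {v}"
    by (simp add: hull_minimal)
  then show "v \<notin> convex hull (vert P - {v})"
    by blast
qed

lemma full_dimensional_lattice_measure_ge:
  fixes V :: "(real ^ 'n) set"
  assumes "finite V" "V \<subseteq> integer_lattice" "full_dimensional (convex hull V)"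
  shows "1 / real CARD('n) ^ CARD('n) \<le> measure lebesgue (convex hull V)"
proof -
  obtain v and f :: "'n \<Rightarrow> real ^ 'n"
    where f: "v \<in> V" "range f \<subseteq> V" "det (\<chi> i j. (f j - v) $ i) \<noteq> 0"
    by (rule full_dimensional_frame[OF assms(3)])
  have "1 / real CARD('n) ^ CARD('n) \<le> measure lebesgue (convex hull (insert v (range f)))"
    using f assms(2) by (intro lattice_simplex_measure_ge) auto
  also have "\<dots> \<le> measure lebesgue (convex hull V)"
  proof (rule measure_mono_fmeasurable)
    show "convex hull (insert v (range f)) \<subseteq> convex hull V"
      using f by (intro hull_mono) auto
    show "convex hull (insert v (range f)) \<in> sets lebesgue"
      by (intro fmeasurableD lmeasurable_compact finite_imp_compact_convex_hull) simp
    show "convex hull V \<in> lmeasurable"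
      using assms(1) by (intro lmeasurable_compact finite_imp_compact_convex_hull)
  qed
  finally show ?thesis .
qed

text \<open>
  The first term bounds the vertices in the sparse subset \<open>W\<close>.  The second bounds the others, each of
  which accounts for volume \<open>d^(-d)\<close> in \<open>P\<close> outside \<open>convex hull W\<close>, where by Bernoulli's inequality at
  most \<open>2 d r^2 Vol P\<close> is available.
\<close>
lemma card_vert_le_two_scale:
  fixes P :: "(real ^ 'n) set"
  assumes P: "lattice_polytope P" "full_dimensional P" and r: "0 < r" "r \<le> 1/2"
  defines "n \<equiv> CARD('n)"
  shows "real (card (vert P)) \<le> (2 * (real n * (2 * real n + 1) + 1)) ^ n * real n / r ^ (n - 1)
    + 2 * real n * r\<^sup>2 * (real n ^ n * measure lebesgue P)"
proof -
  let ?V = "vert P" and ?m = "measure lebesgue P"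
  note V = lattice_polytope_vert[OF P(1)]
  have "finite ?V"
    using P(1) by (rule finite_vert)
  have full: "full_dimensional (convex hull ?V)"
    using P(2) V(1) by simp
  have "n > 0"
    by (simp add: n_def)
  have "1 / real n ^ n \<le> ?m"
    using full_dimensional_lattice_measure_ge[OF \<open>finite ?V\<close> V(2) full] V(1) by (simp add: n_def)
  then have "?m > 0"
    using \<open>n > 0\<close> by (meson less_le_trans divide_pos_pos of_nat_0_less_iff zero_less_one zero_less_power)
  obtain W c where W: "W \<subseteq> ?V"
    and card_W: "real (card W) \<le> (2 * (real n * (2 * real n + 1) + 1)) ^ n * real n / r ^ (n - 1)"
    and copy: "\<And>x. x \<in> convex hull ?V \<Longrightarrow> (1 - 2 * r\<^sup>2) *\<^sub>R x + c \<in> convex hull W"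
    unfolding n_def by (rule sparse_approximating_subset[OF \<open>finite ?V\<close> full r]) blast
  have "finite W"
    using W \<open>finite ?V\<close> by (rule finite_subset)
  have meas: "P \<in> lmeasurable" "convex hull W \<in> lmeasurable"
    using \<open>finite ?V\<close> \<open>finite W\<close> V(1)
    by (metis lmeasurable_compact finite_imp_compact_convex_hull)+
  have r2: "2 * r\<^sup>2 \<le> 1/2"
    using r power_mono[of r "1/2" 2] by (simp add: power2_eq_square)
  have "(1 + - (2 * r\<^sup>2)) ^ n * ?m = measure lebesgue ((\<lambda>x. (1 - 2 * r\<^sup>2) *\<^sub>R x + c) ` P)"
    using r2 by (simp add: measure_dilation n_def)
  also have "\<dots> \<le> measure lebesgue (convex hull W)"
  proof (rule measure_mono_fmeasurable)
    show "(\<lambda>x. (1 - 2 * r\<^sup>2) *\<^sub>R x + c) ` P \<subseteq> convex hull W"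
      using copy V(1) by auto
    have "compact ((\<lambda>x. (1 - 2 * r\<^sup>2) *\<^sub>R x + c) ` P)"
      using V(1) \<open>finite ?V\<close>
      by (intro compact_continuous_image continuous_intros) (metis finite_imp_compact_convex_hull)
    then show "(\<lambda>x. (1 - 2 * r\<^sup>2) *\<^sub>R x + c) ` P \<in> sets lebesgue"
      by (intro fmeasurableD lmeasurable_compact)
  qed (rule meas)
  finally have scaled: "(1 + - (2 * r\<^sup>2)) ^ n * ?m \<le> measure lebesgue (convex hull W)" .
  have "0 < (1 + - (2 * r\<^sup>2)) ^ n * ?m"
    using r2 \<open>?m > 0\<close> by (intro mult_pos_pos zero_less_power) auto
  with scaled have "\<not> negligible (convex hull W)"
    using negligible_imp_measure0[of "convex hull W"] by linarith
  then have "interior (convex hull W) \<noteq> {}"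
    by (simp add: negligible_convex_interior)
  then have "measure lebesgue (convex hull W) + real (card (?V - W)) / real n ^ n \<le> ?m"
    using lattice_vertices_add_volume[OF \<open>finite ?V\<close> V(2,3) W] V(1) by (simp add: n_def)
  moreover have "(1 + real n * (- (2 * r\<^sup>2))) * ?m \<le> (1 + - (2 * r\<^sup>2)) ^ n * ?m"
    using r2 by (intro mult_right_mono Bernoulli_inequality) auto
  moreover have "(1 + real n * (- (2 * r\<^sup>2))) * ?m = ?m - 2 * real n * r\<^sup>2 * ?m"
    by (simp add: algebra_simps)
  ultimately have "real (card (?V - W)) / real n ^ n \<le> 2 * real n * r\<^sup>2 * ?m"
    using scaled by linarith
  then have "real (card (?V - W)) \<le> 2 * real n * r\<^sup>2 * (real n ^ n * ?m)"
    using \<open>n > 0\<close> by (simp add: pos_divide_le_eq mult_ac)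
  moreover have "card ?V = card W + card (?V - W)"
    using W \<open>finite ?V\<close> by (metis card_Diff_subset card_mono finite_subset le_add_diff_inverse)
  ultimately show ?thesis
    using card_W by simp
qed

theorem theorem1:
  shows "\<exists>c::real. c > 0 \<and>
    (\<forall>P :: (real ^ 'n) set. lattice_polytope P \<and> full_dimensional P \<longrightarrow>
      real (card (vert P)) \<le>
        c * measure lebesgue P powr ((real CARD('n) - 1) / (real CARD('n) + 1)))"
proof -
  define n where "n = CARD('n)"
  have "n > 0"
    by (simp add: n_def)
  define e where "e = (real n - 1) / (real n + 1)"
  define A where "A = (2 * (real n * (2 * real n + 1) + 1)) ^ n * real n"
  define c where "c = (A * 2 ^ (n - 1) + real n / 2) * (real n ^ n) powr e"
  have "A > 0"
    using \<open>n > 0\<close> by (simp add: A_def add_pos_pos)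
  then have "c > 0"
    using \<open>n > 0\<close> by (simp add: c_def add_pos_pos)
  moreover have "real (card (vert P)) \<le> c * measure lebesgue P powr e"
    if P: "lattice_polytope P" "full_dimensional P" for P :: "(real ^ 'n) set"
  proof -
    let ?m = "measure lebesgue P"
    define x where "x = real n ^ n * ?m"
    have "1 / real n ^ n \<le> ?m"
      using full_dimensional_lattice_measure_ge[OF finite_vert[OF P(1)] lattice_polytope_vert(2)[OF P(1)]]
        lattice_polytope_vert(1)[OF P(1)] P(2) by (simp add: n_def)
    then have "1 \<le> x"
      using \<open>n > 0\<close> by (simp add: x_def divide_le_eq mult.commute)
    \<comment> \<open>Both terms of the bound become multiples of \<open>x powr e\<close>; the factor \<open>1/2\<close> keeps \<open>r\<close> in the admissible range, as \<open>1 \<le> x\<close>.\<close>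
    define r where "r = (1/2) * x powr (- 1 / (real n + 1))"
    have r: "0 < r" "r \<le> 1/2"
      using \<open>1 \<le> x\<close> powr_mono[of "- 1 / (real n + 1)" 0 x] by (auto simp: r_def)
    have "real (n - 1) * (- 1 / (real n + 1)) = - e"
      using \<open>n > 0\<close> by (simp add: e_def of_nat_diff)
    then have "r ^ (n - 1) = (1/2) ^ (n - 1) * x powr (- e)"
      using \<open>1 \<le> x\<close> powr_power[of x "- 1 / (real n + 1)" "n - 1"]
      unfolding r_def power_mult_distrib by simp
    then have first: "A / r ^ (n - 1) = A * 2 ^ (n - 1) * x powr e"
      unfolding powr_minus_divide power_one_over by simp
    have "r\<^sup>2 * x = (1/4) * (x powr (- 2 / (real n + 1)) * x powr 1)"
      using \<open>1 \<le> x\<close> by (simp add: r_def power2_eq_square flip: powr_add)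
    also have "x powr (- 2 / (real n + 1)) * x powr 1 = x powr (- 2 / (real n + 1) + 1)"
      by (rule powr_add[symmetric])
    also have "- 2 / (real n + 1) + 1 = e"
      by (simp add: e_def divide_simps)
    finally have second: "2 * real n * r\<^sup>2 * x = real n / 2 * x powr e"
      by (simp add: mult.assoc)
    have "real (card (vert P)) \<le> A / r ^ (n - 1) + 2 * real n * r\<^sup>2 * x"
      using card_vert_le_two_scale[OF P r] by (simp add: A_def x_def n_def)
    also have "\<dots> = (A * 2 ^ (n - 1) + real n / 2) * x powr e"
      by (simp only: first second distrib_right)
    also have "\<dots> = c * ?m powr e"
      using \<open>n > 0\<close> by (simp add: c_def x_def powr_mult)
    finally show ?thesis .
  qed
  ultimately show ?thesis
    unfolding e_def n_def by blast
qed

end
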